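(* Consider the LTI planar system $\dot{\mathbf{x}}=A\mathbf{x}+B\mathbf{u}$ with $A\in\mathbb{R}^{2\times2}$ and $B\in\mathbb{R}^{2\times1}$ of full column rank (i.e. $m=1$, the system is underactuated), and suppose it is stabilizable. Let $r:\mathbb{R}\to\mathbb{R}_{>0}$ be a continuously differentiable, $2\pi$-periodic function such that $$\partial\mathcal{C}=\{(r(\theta)\cos\theta,\ r(\theta)\sin\theta):\ \theta\in[0,2\pi]\},$$ let $h$ be a strict CBF of $\mathcal{C}$ and suppose $h(\mathbf{0}_2)>0$. Then the filtered system $\dot{\mathbf{x}}=(A-BK)\mathbf{x}+Bv(\mathbf{x})$ does not have any undesired equilibria, for any $K\in\mathbb{R}^{1\times2}$ such that $A-BK$ is Hurwitz and any linear function $\alpha(s)=\alpha_0 s$, $\alpha_0>0$, for which $h$ is a strict CBF.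
   Context: A function $\alpha:\mathbb{R}\to\mathbb{R}$ is of extended class $\mathcal{K}_\infty$ if it is continuous, strictly increasing, $\alpha(0)=0$ and $\lim_{s\to\pm\infty}\alpha(s)=\pm\infty$. $\mathcal{C}\subset\mathbb{R}^2$ and $h:\mathbb{R}^2\to\mathbb{R}$ is continuously differentiable with $\mathcal{C}=\{h\ge 0\}$ and $\partial\mathcal{C}=\{h=0\}$. $h$ is a strict control barrier function (strict CBF) of $\mathcal{C}$ with associated extended class $\mathcal{K}_\infty$ function $\alpha$ if for every $\mathbf{x}\in\mathcal{C}$ there is $\mathbf{u}\in\mathbb{R}^m$ with $\nabla h(\mathbf{x})^\top(A\mathbf{x}+B\mathbf{u})+\alpha(h(\mathbf{x}))>0$. The nominal controller is $\mathbf{u}=-K\mathbf{x}$. With $\eta(\mathbf{x})=\nabla h(\mathbf{x})^\top(A-BK)\mathbf{x}+\alpha(h(\mathbf{x}))$, the safety filter is $v(\mathbf{x})=0$ if $\eta(\mathbf{x})\ge0$ and $v(\mathbf{x})=-\dfrac{\eta(\mathbf{x})G(\mathbf{x})^{-1}B^\top\nabla h(\mathbf{x})}{\nabla h(\mathbf{x})^\top BG(\mathbf{x})^{-1}B^\top\nabla h(\mathbf{x})}$ if $\eta(\mathbf{x})<0$, with $G:\mathbb{R}^2\to\mathbb{R}^{m\times m}$ continuously differentiable and positive definite; it is well defined on $\mathcal{C}$. Undesired equilibria of the filtered system are the points $\mathbf{x}$ with $h(\mathbf{x})=0$ for which there is $\delta<0$ with $(A-BK)\mathbf{x}=\delta BG(\mathbf{x})^{-1}B^\top\nabla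 h(\mathbf{x})$; equivalently, the equilibria of the filtered system in $\mathcal{C}$ other than the origin. *)

theory Defs
  imports "HOL-Analysis.Analysis"
begin

text \<open>An \<open>r \<times> c\<close> real matrix has type \<open>real^'c^'r\<close>. The states live in \<open>real^'n\<close>, the
  inputs in \<open>real^'m\<close>, so that \<open>A :: real^'n^'n\<close>, \<open>B :: real^'m^'n\<close> and \<open>K :: real^'n^'m\<close>.\<close>

definition continuously_differentiable ::
    "('a::real_normed_vector \<Rightarrow> 'b::real_normed_vector) \<Rightarrow> bool" where
  "continuously_differentiable f \<longleftrightarrow>
     (\<exists>f' :: 'a \<Rightarrow> 'a \<Rightarrow>\<^sub>L 'b.
        (\<forall>x. (f has_derivative blinfun_apply (f' x)) (at x)) \<and> continuous_on UNIV f')"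

text \<open>Only meaningful where the function is differentiable; see \<open>gradient_eqI\<close>.\<close>

definition gradient :: "('a::real_inner \<Rightarrow> real) \<Rightarrow> 'a \<Rightarrow> 'a" where
  "gradient h x = (THE D. GDERIV h x :> D)"

lemma gradient_eqI:
  assumes "GDERIV h x :> D"
  shows "gradient h x = D"
  unfolding gradient_def
proof (rule the_equality)
  show "GDERIV h x :> D" by (fact assms)
next
  fix D' assume "GDERIV h x :> D'"
  with assms have "(\<lambda>v. v \<bullet> D') = (\<lambda>v. v \<bullet> D)"
    unfolding gderiv_def by (metis has_derivative_unique)
  then have "v \<bullet> (D' - D) = 0" for v
    by (simp add: inner_diff_right fun_eq_iff)
  then show "D' = D"
    by (metis inner_eq_zero_iff eq_iff_diff_eq_0)
qed

definition extended_class_K_infinity :: "(real \<Rightarrow> real) \<Rightarrow> bool" where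
  "extended_class_K_infinity \<alpha> \<longleftrightarrow>
     continuous_on UNIV \<alpha> \<and> strict_mono \<alpha> \<and> \<alpha> 0 = 0 \<and>
     filterlim \<alpha> at_top at_top \<and> filterlim \<alpha> at_bot at_bot"

definition strict_CBF ::
    "real^'n^'n \<Rightarrow> real^'m^'n \<Rightarrow> (real^'n) set \<Rightarrow> (real^'n \<Rightarrow> real) \<Rightarrow> (real \<Rightarrow> real) \<Rightarrow> bool" where
  "strict_CBF A B C h \<alpha> \<longleftrightarrow>
     extended_class_K_infinity \<alpha> \<and>
     (\<forall>x\<in>C. \<exists>u. gradient h x \<bullet> (A *v x + B *v u) + \<alpha> (h x) > 0)"

text \<open>All complex eigenvalues have negative real part.\<close>

definition hurwitz :: "real^'n^'n \<Rightarrow> bool" where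
  "hurwitz M \<longleftrightarrow>
     (\<forall>(\<mu>::complex) (v::complex^'n).
        v \<noteq> 0 \<and> map_matrix complex_of_real M *v v = \<mu> *s v \<longrightarrow> Re \<mu> < 0)"

definition stabilizable :: "real^'n^'n \<Rightarrow> real^'m^'n \<Rightarrow> bool" where
  "stabilizable A B \<longleftrightarrow> (\<exists>K :: real^'n^'m. hurwitz (A - B ** K))"

definition positive_definite :: "real^'m^'m \<Rightarrow> bool" where
  "positive_definite M \<longleftrightarrow> transpose M = M \<and> (\<forall>v. v \<noteq> 0 \<longrightarrow> v \<bullet> (M *v v) > 0)"

definition nominal_margin ::
    "real^'n^'n \<Rightarrow> real^'m^'n \<Rightarrow> real^'n^'m \<Rightarrow> (real^'n \<Rightarrow> real) \<Rightarrow> (real \<Rightarrow> real)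
      \<Rightarrow> real^'n \<Rightarrow> real" where
  "nominal_margin A B K h \<alpha> x = gradient h x \<bullet> ((A - B ** K) *v x) + \<alpha> (h x)"

definition safety_filter ::
    "real^'n^'n \<Rightarrow> real^'m^'n \<Rightarrow> real^'n^'m \<Rightarrow> (real^'n \<Rightarrow> real^'m^'m) \<Rightarrow> (real^'n \<Rightarrow> real)
      \<Rightarrow> (real \<Rightarrow> real) \<Rightarrow> real^'n \<Rightarrow> real^'m" where
  "safety_filter A B K G h \<alpha> x =
     (let \<eta> = nominal_margin A B K h \<alpha> x;
          g = gradient h x;
          w = (matrix_inv (G x) ** transpose B) *v g
      in if \<eta> \<ge> 0 then 0 else - (\<eta> / (g \<bullet> (B *v w))) *\<^sub>R w)"

definition filtered_field ::
    "real^'n^'n \<Rightarrow> real^'m^'n \<Rightarrow> real^'n^'m \<Rightarrow> (real^'n \<Rightarrow> real^'m^'m) \<Rightarrow> (real^'n \<Rightarrow> real)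
      \<Rightarrow> (real \<Rightarrow> real) \<Rightarrow> real^'n \<Rightarrow> real^'n" where
  "filtered_field A B K G h \<alpha> x = (A - B ** K) *v x + B *v safety_filter A B K G h \<alpha> x"

definition undesired_equilibria ::
    "real^'n^'n \<Rightarrow> real^'m^'n \<Rightarrow> real^'n^'m \<Rightarrow> (real^'n \<Rightarrow> real^'m^'m) \<Rightarrow> (real^'n \<Rightarrow> real)
      \<Rightarrow> (real^'n) set" where
  "undesired_equilibria A B K G h =
     {x. h x = 0 \<and>
         (\<exists>\<delta><0. (A - B ** K) *v x =
                 \<delta> *\<^sub>R ((B ** matrix_inv (G x) ** transpose B) *v gradient h x))}"

end

theory Submission
  imports Defs
begin

text \<open>Let \<open>M = A - BK\<close>. An undesired equilibrium \<open>x\<close> lies on \<open>\<partial>C\<close>, \<open>M x\<close> spans the column \<open>b\<close> of \<open>B\<close>, and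
  \<open>\<nabla>h(x) \<bullet> M x < 0\<close>; as \<open>C\<close> is star-shaped, \<open>\<nabla>h(x) \<bullet> x \<le> 0\<close>. If \<open>M x\<close> is parallel to \<open>x\<close>, the
  eigenvalue is negative, a contradiction. Otherwise write \<open>y = l x + m M x\<close>. Since \<open>M x\<close> points out of
  \<open>C\<close> at \<open>x\<close>, the points of \<open>C\<close> with \<open>m \<le> 0\<close> reach beyond \<open>l = 1\<close>, and by star-shapedness the maximum of
  \<open>l\<close> over them is attained at some \<open>z \<in> \<partial>C\<close> with \<open>m < 0\<close>. There \<open>\<nabla>h(z) \<bullet> b = 0\<close> and
  \<open>\<nabla>h(z) \<bullet> x \<le> 0\<close>, so the input has no effect on \<open>h\<close>, while by Cayley-Hamilton the drift satisfies
  \<open>\<nabla>h(z) \<bullet> M z = - m det(M) (\<nabla>h(z) \<bullet> x) \<le> 0\<close>, contradicting the strict CBF condition.\<close>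

section \<open>Gradients and directional derivatives\<close>

lemma continuously_differentiable_imp_continuous_on:
  assumes "continuously_differentiable f"
  shows "continuous_on S f"
  using assms unfolding continuously_differentiable_def
  by (meson continuous_at_imp_continuous_on has_derivative_continuous)

lemma continuously_differentiable_imp_GDERIV:
  fixes h :: "'a::euclidean_space \<Rightarrow> real"
  assumes "continuously_differentiable h"
  shows "GDERIV h x :> gradient h x"
proof -
  obtain f where f: "(h has_derivative blinfun_apply f) (at x)"
    using assms unfolding continuously_differentiable_def by blast
  \<comment> \<open>The adjoint of the derivative, applied to 1, is its Riesz
    representative.\<close>
  have "blinfun_apply f v = v \<bullet> adjoint (blinfun_apply f) 1" for v
    using adjoint_works[OF has_derivative_linear[OF f], of v 1] by simp
  then have "GDERIV h x :> adjoint (blinfun_apply f) 1"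
    unfolding gderiv_def using f has_derivative_eq_rhs by (metis (no_types, lifting) ext)
  then show ?thesis
    using gradient_eqI by metis
qed

lemma GDERIV_pos_direction_increase:
  assumes "GDERIV h z :> g" and "0 < g \<bullet> v"
  shows "\<exists>d>0. \<forall>t>0. t < d \<longrightarrow> h z < h (z + t *\<^sub>R v)"
proof -
  have "((\<lambda>t. h (z + t *\<^sub>R v)) has_derivative (\<lambda>t. (t *\<^sub>R v) \<bullet> g)) (at 0)"
    using assms(1) unfolding gderiv_def
    by (intro has_derivative_compose[where f="\<lambda>t. z + t *\<^sub>R v" and g=h])
       (auto intro!: derivative_eq_intros)
  then have "((\<lambda>t. h (z + t *\<^sub>R v)) has_real_derivative (g \<bullet> v)) (at 0)"
    by (rule has_derivative_imp_has_field_derivative) (simp add: inner_commute)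
  from DERIV_pos_inc_right[OF this assms(2)] show ?thesis by auto
qed

section \<open>Planar Hurwitz matrices\<close>

lemma hurwitz_real_eigenvalue_neg:
  fixes M :: "real^'n^'n"
  assumes "hurwitz M" and "v \<noteq> 0" and "M *v v = c *\<^sub>R v"
  shows "c < 0"
proof -
  let ?v = "\<chi> i. complex_of_real (v $ i)"
  have "map_matrix complex_of_real M *v ?v = complex_of_real c *s ?v"
  proof (rule vec_eq_iff[THEN iffD2], rule allI)
    fix i
    have "(M *v v) $ i = c * v $ i" using assms(3) by simp
    then have "(\<Sum>j\<in>UNIV. M $ i $ j * v $ j) = c * v $ i"
      by (simp add: matrix_vector_mult_def)
    then show "(map_matrix complex_of_real M *v ?v) $ i = (complex_of_real c *s ?v) $ i"
      by (simp add: matrix_vector_mult_def map_matrix_def flip: of_real_mult of_real_sum)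
  qed
  moreover have "?v \<noteq> 0"
    using assms(2) by (simp add: vec_eq_iff)
  ultimately show ?thesis
    using assms(1) unfolding hurwitz_def by fastforce
qed

lemma matrix_vector_mult_2:
  fixes M :: "real^2^2"
  shows "(M *v v) $ 1 = M$1$1 * v$1 + M$1$2 * v$2" "(M *v v) $ 2 = M$2$1 * v$1 + M$2$2 * v$2"
  by (simp_all add: matrix_vector_mult_def sum_2)

text \<open>With a nonpositive determinant the discriminant is at least the squared trace, so the
  larger root \<open>c\<close> of the characteristic polynomial is real and nonnegative. It would be
  a forbidden eigenvalue.\<close>

lemma hurwitz_2_det_pos:
  fixes M :: "real^2^2"
  assumes "hurwitz M"
  shows "det M > 0"
proof (rule ccontr)
  assume "\<not> det M > 0"
  then have d: "det M \<le> 0" by simp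
  define \<tau> where "\<tau> = trace M"
  define s where "s = sqrt (\<tau>\<^sup>2 - 4 * det M)"
  define c where "c = (\<tau> + s) / 2"
  have s2: "s\<^sup>2 = \<tau>\<^sup>2 - 4 * det M"
    unfolding s_def using d by (intro real_sqrt_pow2) (smt (verit) zero_le_power2)
  have "\<bar>\<tau>\<bar> \<le> s"
    unfolding s_def by (rule real_le_rsqrt) (use d in simp)
  then have c: "c \<ge> 0" by (simp add: c_def)
  have "c\<^sup>2 - \<tau> * c + det M = 0"
    using s2 by (simp add: c_def power2_eq_square field_simps)
  then have "det (M - mat c) = 0"
    by (simp add: det_2 mat_def \<tau>_def trace_def sum_2 power2_eq_square algebra_simps)
  then have "\<not> invertible (M - mat c)"
    by (simp add: invertible_det_nz)
  then obtain v where v: "v \<noteq> 0" "(M - mat c) *v v = 0"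
    unfolding invertible_left_inverse matrix_left_invertible_ker by blast
  have "M *v v = c *\<^sub>R v"
    using v(2) by (simp add: vec_eq_iff forall_2 matrix_vector_mult_2 mat_def algebra_simps)
  with hurwitz_real_eigenvalue_neg[OF assms v(1)] c show False by fastforce
qed

lemma cayley_hamilton_2:
  fixes M :: "real^2^2"
  shows "M *v (M *v v) = trace M *\<^sub>R (M *v v) - det M *\<^sub>R v"
  by (simp add: vec_eq_iff forall_2 matrix_vector_mult_2 trace_def sum_2 det_2 algebra_simps)

section \<open>Sets whose frontier is a polar curve\<close>

text \<open>Rewrites the polar parametrisation as a sum to which the continuity rules apply.\<close>

lemma vector_2_axis: "(vector [a, b] :: real^2) = a *\<^sub>R axis 1 1 + b *\<^sub>R axis 2 1"
  by (simp add: vec_eq_iff forall_2 axis_def)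

text \<open>Scaling the curve by factors below and above 1 gives two connected regions
  \<open>I\<close> and \<open>E\<close> that miss the frontier, so each lies inside \<open>C\<close>
  or is disjoint from it. \<open>I\<close> contains the origin, hence lies in \<open>C\<close>. If
  \<open>E\<close> met \<open>C\<close>, then \<open>C\<close> would be the whole plane, whose
  frontier is empty.\<close>

lemma polar_frontier_outside:
  fixes C :: "(real^2) set" and r :: "real \<Rightarrow> real"
  assumes C: "closed C" "0 \<in> C"
    and r: "continuous_on UNIV r" "\<And>\<theta>. r \<theta> > 0" "r (2 * pi) = r 0"
    and fr: "frontier C = (\<lambda>\<theta>. vector [r \<theta> * cos \<theta>, r \<theta> * sin \<theta>]) ` {0..2 * pi}"
    and \<theta>: "\<theta> \<in> {0..2*pi}" and t: "t > 1"
  shows "t *\<^sub>R vector [r \<theta> * cos \<theta>, r \<theta> * sin \<theta>] \<notin> C"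
proof -
  define p :: "real \<Rightarrow> real \<Rightarrow> real^2"
    where "p s \<theta> = (s * r \<theta> * cos \<theta>) *\<^sub>R axis 1 1 + (s * r \<theta> * sin \<theta>) *\<^sub>R axis 2 1" for s \<theta>
  have p: "s *\<^sub>R vector [r \<theta> * cos \<theta>, r \<theta> * sin \<theta>] = p s \<theta>" for s \<theta>
    by (simp add: p_def vector_2_axis scaleR_add_right mult.assoc)
  have fr': "frontier C = p 1 ` {0..2*pi}"
    unfolding fr using p[of 1] by simp
  have p_eq: "s = 1" if "p s \<theta> = p 1 \<phi>" "s \<ge> 0" "\<theta> \<in> {0..2*pi}" "\<phi> \<in> {0..2*pi}" for s \<theta> \<phi>
  proof -
    have e: "s * r \<theta> * cos \<theta> = r \<phi> * cos \<phi>" "s * r \<theta> * sin \<theta> = r \<phi> * sin \<phi>"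
      using that(1) by (auto simp: p_def vec_eq_iff forall_2 axis_def)
    have "(s * r \<theta>)\<^sup>2 = (s * r \<theta> * cos \<theta>)\<^sup>2 + (s * r \<theta> * sin \<theta>)\<^sup>2"
      by (simp add: power_mult_distrib flip: distrib_left)
    also have "\<dots> = (r \<phi>)\<^sup>2"
      unfolding e by (simp add: power_mult_distrib flip: distrib_left)
    finally have sr: "s * r \<theta> = r \<phi>"
      by (rule power2_eq_imp_eq) (use r(2)[of \<theta>] r(2)[of \<phi>] that(2) in auto)
    then have "cos \<theta> = cos \<phi>" "sin \<theta> = sin \<phi>"
      using e r(2)[of \<phi>] by auto
    then obtain n :: int where n: "\<theta> = \<phi> + 2 * pi * n"
      using sin_cos_eq_iff by metis
    have "\<bar>2 * pi * real_of_int n\<bar> \<le> 2 * pi * 1"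
      using n that(3,4) by auto
    then have "\<bar>n\<bar> \<le> 1"
      by (simp add: abs_mult)
    then consider "n = 0" | "n = 1" | "n = -1" by linarith
    \<comment> \<open>Two angles with the same direction can differ only at the two ends of the
      interval, where the closing condition on \<open>r\<close> applies.\<close>
    then have "r \<theta> = r \<phi>"
    proof cases
      case 2
      then have "\<theta> = 2*pi" "\<phi> = 0" using n that(3,4) by auto
      then show ?thesis using r(3) by simp
    next
      case 3
      then have "\<theta> = 0" "\<phi> = 2*pi" using n that(3,4) by auto
      then show ?thesis using r(3) by simp
    qed (use n in simp)
    with sr r(2)[of \<phi>] show ?thesis by simp
  qed
  have conn: "connected ((\<lambda>z. p (fst z) (snd z)) ` (T \<times> {0..2*pi}))" if "connected T" for T
  proof (rule connected_continuous_image)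
    have "continuous_on (T \<times> {0..2*pi}) (\<lambda>z. r (snd z))"
      by (rule continuous_on_compose2[OF r(1)]) (auto intro: continuous_intros)
    then show "continuous_on (T \<times> {0..2*pi}) (\<lambda>z. p (fst z) (snd z))"
      unfolding p_def by (intro continuous_intros)
    show "connected (T \<times> {0..2*pi})"
      using that by (intro connected_Times) auto
  qed
  define I where "I = (\<lambda>z. p (fst z) (snd z)) ` ({0..<1} \<times> {0..2*pi})"
  define E where "E = (\<lambda>z. p (fst z) (snd z)) ` ({1<..} \<times> {0..2*pi})"
  have I: "connected I" "I \<inter> frontier C = {}" and E: "connected E" "E \<inter> frontier C = {}"
    unfolding I_def E_def fr' by (auto intro!: conn dest!: p_eq)
  have "p 0 0 \<in> I" unfolding I_def by force
  then have "0 \<in> I" by (simp add: p_def)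
  then have IC: "I \<subseteq> C"
    using connected_Int_frontier[OF I(1)] I(2) C(2) by blast
  have cover: "y \<in> I \<union> frontier C \<union> E" for y :: "real^2"
  proof (cases "y = 0")
    case False
    define \<rho> where "\<rho> = norm y"
    have \<rho>: "\<rho> > 0" "\<rho>\<^sup>2 = (y$1)\<^sup>2 + (y$2)\<^sup>2"
      using False by (simp add: \<rho>_def, simp add: \<rho>_def norm_vec_def L2_set_def sum_2)
    have "(y$1 / \<rho>)\<^sup>2 + (y$2 / \<rho>)\<^sup>2 = 1"
      unfolding power_divide add_divide_distrib[symmetric] \<rho>(2)[symmetric] using \<rho>(1) by simp
    then obtain \<phi> where \<phi>: "0 \<le> \<phi>" "\<phi> < 2*pi" "y$1 / \<rho> = cos \<phi>" "y$2 / \<rho> = sin \<phi>"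
      using sincos_total_2pi by metis
    have y: "y = p (\<rho> / r \<phi>) \<phi>"
      using \<rho>(1) r(2)[of \<phi>] \<phi>(3,4)
      by (simp add: p_def vec_eq_iff forall_2 axis_def field_simps)
    have "\<rho> / r \<phi> > 0" using \<rho>(1) r(2)[of \<phi>] by simp
    then consider "\<rho> / r \<phi> \<in> {0..<1}" | "\<rho> / r \<phi> = 1" | "\<rho> / r \<phi> \<in> {1<..}"
      by (cases "\<rho> / r \<phi>" "1 :: real" rule: linorder_cases) simp_all
    then show ?thesis
    proof cases
      case 1
      then show ?thesis using y \<phi> unfolding I_def by (auto intro!: image_eqI[of _ _ "(\<rho> / r \<phi>, \<phi>)"])
    next
      case 2
      then show ?thesis using y \<phi> unfolding fr' by auto
    next
      case 3
      then show ?thesis using y \<phi> unfolding E_def by (auto intro!: image_eqI[of _ _ "(\<rho> / r \<phi>, \<phi>)"])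
    qed
  qed (use \<open>0 \<in> I\<close> in simp)
  have "E \<inter> C = {}"
  proof (rule ccontr)
    assume "E \<inter> C \<noteq> {}"
    then have "E \<subseteq> C"
      using connected_Int_frontier[OF E(1)] E(2) by blast
    then have "C = UNIV"
      using cover IC frontier_subset_closed[OF C(1)] by blast
    then have "frontier C = {}" by simp
    then show False by (simp add: fr)
  qed
  moreover have "p t \<theta> \<in> E"
    using t \<theta> unfolding E_def by (auto intro!: image_eqI[of _ _ "(t, \<theta>)"])
  ultimately show ?thesis unfolding p by blast
qed

text \<open>In dimension at least 2 the complement of a ball containing the frontier is connected
  and misses the frontier. It contains a far point of the ray through \<open>x\<close>, which is not
  in \<open>C\<close>, so all of it avoids \<open>C\<close>.\<close>

lemma bounded_frontier_imp_bounded: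
  fixes C :: "'a::euclidean_space set"
  assumes "DIM('a) \<ge> 2" and "bounded (frontier C)" and x: "x \<in> frontier C" "x \<noteq> 0"
    and out: "\<And>t. t > 1 \<Longrightarrow> t *\<^sub>R x \<notin> C"
  shows "bounded C"
proof -
  obtain b where b: "b > 0" "\<And>y. y \<in> frontier C \<Longrightarrow> norm y \<le> b"
    using assms(2) by (metis bounded_pos)
  have conn: "connected (- cball (0::'a) b)"
    by (intro connected_complement_bounded_convex assms(1)) auto
  \<comment> \<open>Then \<open>t *\<^sub>R x\<close> has norm \<open>b + 2 * norm x\<close>, beyond
    the ball, and \<open>t\<close> exceeds 1.\<close>
  define t where "t = b / norm x + 2"
  have "norm (t *\<^sub>R x) > b" "t > 1"
    using b(1) x(2) by (auto simp: t_def field_simps abs_of_pos add_pos_pos)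
  with out have "t *\<^sub>R x \<in> - cball 0 b - C" by auto
  moreover have "- cball 0 b \<inter> frontier C = {}"
    using b(2) by force
  ultimately have "- cball 0 b \<inter> C = {}"
    using connected_Int_frontier[OF conn, of C] by blast
  then have "C \<subseteq> cball 0 b" by auto
  then show ?thesis using bounded_cball bounded_subset by blast
qed

section \<open>The extremal argument in oblique coordinates\<close>

text \<open>Cramer's rule: both coordinates are quotients of determinants by that of
  \<open>x\<close> and \<open>b\<close>.\<close>

lemma coordinates_2:
  fixes x b :: "real^2"
  assumes D: "x$1 * b$2 - x$2 * b$1 \<noteq> 0"
  obtains l m :: "real^2 \<Rightarrow> real"
  where "linear l" "linear m" "\<And>y. y = l y *\<^sub>R x + m y *\<^sub>R b" "l x = 1" "m x = 0" "l b = 0" "m b = 1"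
proof -
  let ?D = "x$1 * b$2 - x$2 * b$1"
  let ?l = "\<lambda>y. (y$1 * b$2 - y$2 * b$1) / ?D" and ?m = "\<lambda>y. (x$1 * y$2 - x$2 * y$1) / ?D"
  have "linear ?l" "linear ?m"
    by (rule linearI; simp add: algebra_simps flip: add_divide_distrib diff_divide_distrib)+
  moreover have "y = ?l y *\<^sub>R x + ?m y *\<^sub>R b" for y
  proof -
    have "?D * y$i = (y$1 * b$2 - y$2 * b$1) * x$i + (x$1 * y$2 - x$2 * y$1) * b$i" for i
      using exhaust_2[of i] by (auto simp: algebra_simps)
    then have "y$i = ((y$1 * b$2 - y$2 * b$1) * x$i + (x$1 * y$2 - x$2 * y$1) * b$i) / ?D" for i
      using D by (metis nonzero_mult_div_cancel_left)
    moreover have "((y$1 * b$2 - y$2 * b$1) * x$i + (x$1 * y$2 - x$2 * y$1) * b$i) / ?D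
        = (?l y *\<^sub>R x + ?m y *\<^sub>R b) $ i" for i
      by (simp add: add_divide_distrib)
    ultimately show ?thesis
      unfolding vec_eq_iff by metis
  qed
  ultimately show thesis
    using D by (intro that[of ?l ?m]) (auto simp: mult.commute)
qed

text \<open>The input matrix is abstracted away: \<open>M *v x\<close> stands for its direction, and
  \<open>cbf\<close> is what the strict CBF condition leaves at boundary points where the input
  cannot influence \<open>h\<close>.\<close>

lemma nominal_inflow_on_input_line:
  fixes M :: "real^2^2" and h :: "real^2 \<Rightarrow> real"
  assumes M: "hurwitz M"
    and g: "\<And>y. GDERIV h y :> g y"
    and bdd: "bounded {y. h y \<ge> 0}"
    and x: "h x = 0" "\<And>t. t > 1 \<Longrightarrow> h (t *\<^sub>R x) < 0"
    and cbf: "\<And>y. \<lbrakk>h y = 0; g y \<bullet> (M *v x) = 0\<rbrakk> \<Longrightarrow> g y \<bullet> (M *v y) > 0"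
  shows "g x \<bullet> (M *v x) \<ge> 0"
proof (rule ccontr)
  assume neg: "\<not> ?thesis"
  define b where "b = M *v x"
  have gb: "g x \<bullet> b < 0" using neg by (simp add: b_def)
  have increase: "\<exists>d>0. \<forall>t>0. t < d \<longrightarrow> h z < h (z + t *\<^sub>R v)" if "0 < g z \<bullet> v" for z v
    using GDERIV_pos_direction_increase[OF g that] .
  have cont: "continuous_on UNIV h"
    using g unfolding gderiv_def
    by (meson continuous_at_imp_continuous_on has_derivative_continuous)
  have gx: "g x \<bullet> x \<le> 0"
  proof (rule ccontr)
    assume "\<not> ?thesis"
    then obtain d where "d > 0" "\<And>t. \<lbrakk>t > 0; t < d\<rbrakk> \<Longrightarrow> h x < h (x + t *\<^sub>R x)"
      using increase[of x x] by auto
    then have "h x < h ((1 + d/2) *\<^sub>R x)" by (simp add: scaleR_left_distrib)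
    with x(1) x(2)[of "1 + d/2"] \<open>d > 0\<close> show False by simp
  qed
  show False
  proof (cases "x$1 * b$2 - x$2 * b$1 = 0")
    case True
    have "x \<noteq> 0" using x(1) x(2)[of 2] by auto
    have "\<exists>c. b = c *\<^sub>R x"
    proof (cases "x$1 = 0")
      case True
      then have "x$2 \<noteq> 0" using \<open>x \<noteq> 0\<close> by (auto simp: vec_eq_iff forall_2)
      then have "b = (b$2 / x$2) *\<^sub>R x"
        using True \<open>x$1 * b$2 - x$2 * b$1 = 0\<close> by (auto simp: vec_eq_iff forall_2)
      then show ?thesis by blast
    next
      case False
      then have "b = (b$1 / x$1) *\<^sub>R x"
        using \<open>x$1 * b$2 - x$2 * b$1 = 0\<close> by (auto simp: vec_eq_iff forall_2 field_simps)
      then show ?thesis by blast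
    qed
    then obtain c where c: "b = c *\<^sub>R x" by blast
    with hurwitz_real_eigenvalue_neg[OF M \<open>x \<noteq> 0\<close>, of c] have "c < 0" by (simp add: b_def)
    with gx gb c show False by (simp add: mult_less_0_iff)
  next
    case False
    obtain l m where lm: "linear l" "linear m" "\<And>y. y = l y *\<^sub>R x + m y *\<^sub>R b"
      "l x = 1" "m x = 0" "l b = 0" "m b = 1"
      using coordinates_2[OF False] by blast
    have contlm: "continuous_on UNIV l" "continuous_on UNIV m"
      using lm(1,2) by (auto intro: linear_continuous_on linear_conv_bounded_linear[THEN iffD1])
    define S where "S = {y. h y \<ge> 0} \<inter> {y. m y \<le> 0}"
    have "closed {y. h y \<ge> 0}" "closed {y. m y \<le> 0}"
      using cont contlm by (auto intro!: closed_Collect_le continuous_intros)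
    then have "compact S"
      unfolding S_def using bdd by (simp add: bounded_Int closed_Int compact_eq_bounded_closed)
    moreover have "x \<in> S" using x(1) lm(5) by (simp add: S_def)
    ultimately obtain z where z: "z \<in> S" "\<And>y. y \<in> S \<Longrightarrow> l y \<le> l z"
      using continuous_attains_sup[of S l] contlm(1) continuous_on_subset by blast
    have "l z > 1"
    proof -
      \<comment> \<open>Writing \<open>s\<close> for \<open>g x \<bullet> x\<close>, the derivative
        of \<open>h\<close> along \<open>e *\<^sub>R x - b\<close> is \<open>e * (1 - s)\<close>,
        which is positive. The \<open>- 1\<close> keeps the denominator negative even when
        \<open>s\<close> is 0.\<close>
      define e where "e = (g x \<bullet> b) / (2 * (g x \<bullet> x) - 1)"
      have e: "e > 0" using gb gx by (simp add: e_def zero_less_divide_iff)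
      have "e * (g x \<bullet> x) > g x \<bullet> b"
      proof -
        have "(2 * (g x \<bullet> x) - 1) * e = g x \<bullet> b" using gx by (simp add: e_def)
        moreover have "e * (g x \<bullet> x) \<le> 0" using e gx by (simp add: mult_nonneg_nonpos)
        ultimately show ?thesis using e by (simp add: algebra_simps)
      qed
      then have "0 < g x \<bullet> (e *\<^sub>R x - b)" by (simp add: inner_diff_right)
      then obtain d where d: "d > 0" "\<And>t. \<lbrakk>t > 0; t < d\<rbrakk> \<Longrightarrow> h x < h (x + t *\<^sub>R (e *\<^sub>R x - b))"
        using increase by blast
      let ?y = "x + (d/2) *\<^sub>R (e *\<^sub>R x - b)"
      have "m ?y = - d/2" "l ?y = 1 + d/2 * e"
        using lm by (simp_all add: linear_add linear_diff linear_scale)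
      moreover from this have "?y \<in> S" using d(1) d(2)[of "d/2"] x(1) by (simp add: S_def)
      ultimately show ?thesis using z(2)[of ?y] d(1) e by (smt (verit) half_gt_zero mult_pos_pos)
    qed
    \<comment> \<open>Otherwise \<open>z\<close> would lie on the ray through \<open>x\<close>,
      beyond \<open>x\<close>, where \<open>h\<close> is negative.\<close>
    have "m z \<noteq> 0"
    proof
      assume "m z = 0"
      then have "z = l z *\<^sub>R x" using lm(3)[of z] by simp
      with x(2)[OF \<open>l z > 1\<close>] z(1) show False by (simp add: S_def)
    qed
    then have mz: "m z < 0" using z(1) by (simp add: S_def)
    \<comment> \<open>The constraint \<open>m \<le> 0\<close> is inactive at \<open>z\<close>, so
      only \<open>h \<ge> 0\<close> can restrict small moves.\<close>
    have near: "\<exists>d>0. \<forall>t>0. t < d \<longrightarrow> m (z + t *\<^sub>R v) < 0" for v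
    proof -
      have "((\<lambda>t. m (z + t *\<^sub>R v)) \<longlongrightarrow> m (z + 0 *\<^sub>R v)) (at_right 0)"
        by (intro continuous_on_tendsto_compose[OF contlm(2)] tendsto_intros) auto
      then have "eventually (\<lambda>t. m (z + t *\<^sub>R v) < 0) (at_right 0)"
        using mz by (intro order_tendstoD(2)[where y="m z"]) auto
      then show ?thesis
        by (auto simp: eventually_at_right_field)
    qed
    \<comment> \<open>Staying in \<open>{y. h y \<ge> 0}\<close> while \<open>l\<close> grows would
      contradict the maximality of \<open>l z\<close>.\<close>
    have blocked: "\<not> (\<exists>d>0. \<forall>t>0. t < d \<longrightarrow> h (z + t *\<^sub>R v) \<ge> 0)" if "l v > 0" for v
    proof
      assume "\<exists>d>0. \<forall>t>0. t < d \<longrightarrow> h (z + t *\<^sub>R v) \<ge> 0"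
      then obtain d d' where d: "d > 0" "\<And>t. \<lbrakk>t > 0; t < d\<rbrakk> \<Longrightarrow> h (z + t *\<^sub>R v) \<ge> 0"
        and d': "d' > 0" "\<And>t. \<lbrakk>t > 0; t < d'\<rbrakk> \<Longrightarrow> m (z + t *\<^sub>R v) < 0"
        using near by metis
      define t where "t = min d d' / 2"
      have t: "t > 0" "t < d" "t < d'" using d(1) d'(1) by (auto simp: t_def)
      have "z + t *\<^sub>R v \<in> S" using d(2)[OF t(1,2)] d'(2)[OF t(1,3)] by (simp add: S_def)
      moreover have "l (z + t *\<^sub>R v) = l z + t * l v"
        using lm(1) by (simp add: linear_add linear_scale)
      ultimately show False using z(2) that t(1) by (smt (verit) mult_pos_pos)
    qed
    have hz: "h z = 0"
    proof (rule ccontr)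
      assume "h z \<noteq> 0"
      then have "h z > 0" using z(1) by (simp add: S_def)
      have "((\<lambda>t. h (z + t *\<^sub>R x)) \<longlongrightarrow> h (z + 0 *\<^sub>R x)) (at_right 0)"
        by (intro continuous_on_tendsto_compose[OF cont] tendsto_intros) auto
      then have "eventually (\<lambda>t. h (z + t *\<^sub>R x) > 0) (at_right 0)"
        using \<open>h z > 0\<close> by (intro order_tendstoD(1)[where y="h z"]) auto
      then show False
        using blocked[of x] lm(4) by (fastforce simp: eventually_at_right_field)
    qed
    \<comment> \<open>First-order optimality: if \<open>h\<close> increased from its value 0 along
      \<open>v\<close>, the move would remain feasible.\<close>
    have dir: "g z \<bullet> v \<le> 0" if "l v > 0" for v
      using increase[of z v] blocked[OF that] hz by (metis less_eq_real_def not_le)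
    have gzx: "g z \<bullet> x \<le> 0" using dir[of x] lm(4) by simp
    have "g z \<bullet> b = 0"
    proof (rule ccontr)
      assume n: "g z \<bullet> b \<noteq> 0"
      \<comment> \<open>Adding a multiple of \<open>b\<close> leaves \<open>l\<close> unchanged, and
        this \<open>k\<close> makes \<open>g z \<bullet> (x + k *\<^sub>R b)\<close> equal to 1,
        against \<open>dir\<close>.\<close>
      define k where "k = (1 - g z \<bullet> x) / (g z \<bullet> b)"
      have "l (x + k *\<^sub>R b) = 1" using lm by (simp add: linear_add linear_scale)
      then have "g z \<bullet> (x + k *\<^sub>R b) \<le> 0" by (intro dir) simp
      then show False using n by (simp add: inner_add_right k_def)
    qed
    \<comment> \<open>Apply \<open>M\<close> to
      \<open>z = l z *\<^sub>R x + m z *\<^sub>R b\<close>. The terms along \<open>b\<close> vanish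
      against \<open>g z\<close>; only the determinant term of \<open>M *v b\<close>
      survives.\<close>
    moreover have "g z \<bullet> (M *v z) = - (det M * m z * (g z \<bullet> x))"
    proof -
      have "M *v z = l z *\<^sub>R b + m z *\<^sub>R (trace M *\<^sub>R b - det M *\<^sub>R x)"
        using cayley_hamilton_2[of M x] unfolding b_def[symmetric]
        by (subst lm(3)[of z]) (simp add: matrix_vector_right_distrib scaleR_matrix_vector_assoc
            matrix_vector_mult_scaleR flip: b_def)
      then show ?thesis
        using \<open>g z \<bullet> b = 0\<close> by (simp add: inner_add_right inner_diff_right)
    qed
    ultimately have "det M * m z * (g z \<bullet> x) < 0"
      using cbf[OF hz] by (simp add: b_def)
    moreover have "det M * m z * (g z \<bullet> x) \<ge> 0"
      using hurwitz_2_det_pos[OF M] mz gzx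
      by (intro mult_nonpos_nonpos) (auto simp: mult_nonneg_nonpos)
    ultimately show False by simp
  qed
qed

section \<open>Scalar inputs and the filter direction\<close>

lemma matrix_vector_mult_col:
  fixes B :: "real^1^'n"
  shows "B *v w = w$1 *\<^sub>R column 1 B"
  by (simp add: matrix_vector_mult_def column_def vec_eq_iff UNIV_1)

lemma positive_definite_1_inv:
  fixes G :: "real^1^1"
  assumes "positive_definite G"
  shows "matrix_inv G $ 1 $ 1 > 0"
proof -
  have "(1 :: real^1) \<bullet> (G *v 1) > 0"
    using assms by (simp add: positive_definite_def)
  then have G: "G$1$1 > 0"
    by (simp add: inner_vec_def matrix_vector_mult_def UNIV_1)
  then have "invertible G"
    by (simp add: invertible_det_nz det_1)
  then have "G ** matrix_inv G = mat 1"
    unfolding invertible_def matrix_inv_def by (rule someI2_ex) blast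
  then have "(G ** matrix_inv G)$1$1 = (mat 1 :: real^1^1)$1$1"
    by simp
  then have "G$1$1 * matrix_inv G$1$1 = 1"
    by (simp add: matrix_matrix_mult_def mat_def UNIV_1)
  with G show ?thesis
    by (metis zero_less_mult_pos zero_less_one)
qed

text \<open>With a single input the filter can push only along the column of \<open>B\<close>; the
  matrix weight reduces to a scalar factor.\<close>

lemma filter_direction:
  fixes B :: "real^1^'n" and P :: "real^1^1"
  shows "B *v ((P ** transpose B) *v g) = (P$1$1 * (g \<bullet> column 1 B)) *\<^sub>R column 1 B"
proof -
  have "(transpose B *v g)$1 = g \<bullet> column 1 B"
    by (simp add: matrix_vector_mult_def transpose_def column_def inner_vec_def mult.commute)
  moreover have "((P ** transpose B) *v g)$1 = P$1$1 * (transpose B *v g)$1"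
    unfolding matrix_vector_mul_assoc[symmetric]
    by (subst matrix_vector_mult_def) (simp add: UNIV_1)
  ultimately show ?thesis
    unfolding matrix_vector_mult_col[of B] by simp
qed

section \<open>Excluding equilibria of the filtered system\<close>

theorem proposition5p1:
  fixes A :: "real^2^2" and B :: "real^1^2"
    and C :: "(real^2) set" and h :: "real^2 \<Rightarrow> real"
    and G :: "real^2 \<Rightarrow> real^1^1" and r :: "real \<Rightarrow> real"
  assumes full_column_rank: "rank B = 1"
    and stabilizable: "stabilizable A B"
    and h_C1: "continuously_differentiable h"
    and C_eq: "C = {x. h x \<ge> 0}"
    and frontier_C: "frontier C = {x. h x = 0}"
    and r_C1: "continuously_differentiable r"
    and r_periodic: "\<And>\<theta>. r (\<theta> + 2 * pi) = r \<theta>"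
    and r_pos: "\<And>\<theta>. r \<theta> > 0"
    and frontier_polar:
      "frontier C = (\<lambda>\<theta>. vector [r \<theta> * cos \<theta>, r \<theta> * sin \<theta>]) ` {0..2 * pi}"
    and h_strict_CBF: "\<exists>\<alpha>. strict_CBF A B C h \<alpha>"
    and h_origin: "h 0 > 0"
    and G_C1: "continuously_differentiable G"
    and G_pos_def: "\<And>x. positive_definite (G x)"
  shows "\<forall>(K :: real^2^1) \<alpha>\<^sub>0. hurwitz (A - B ** K) \<and> \<alpha>\<^sub>0 > 0 \<and> strict_CBF A B C h (\<lambda>s. \<alpha>\<^sub>0 * s) \<longrightarrow>
           undesired_equilibria A B K G h = {} \<and>
           {x \<in> C. filtered_field A B K G h (\<lambda>s. \<alpha>\<^sub>0 * s) x = 0 \<and> x \<noteq> 0} = {}"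
proof (intro allI impI, elim conjE)
  fix K :: "real^2^1" and \<alpha>\<^sub>0 :: real
  assume hurw: "hurwitz (A - B ** K)" and \<alpha>: "\<alpha>\<^sub>0 > 0"
    and cbf: "strict_CBF A B C h (\<lambda>s. \<alpha>\<^sub>0 * s)"
  define M where "M = A - B ** K"
  define b where "b = column 1 B"
  define \<gamma> where "\<gamma> x = matrix_inv (G x) $ 1 $ 1" for x
  have M: "hurwitz M" using hurw by (simp add: M_def)
  have \<gamma>: "\<gamma> x > 0" for x
    unfolding \<gamma>_def using positive_definite_1_inv G_pos_def by blast
  have dir: "B *v ((matrix_inv (G x) ** transpose B) *v g) = (\<gamma> x * (g \<bullet> b)) *\<^sub>R b" for x g
    unfolding filter_direction \<gamma>_def b_def ..
  have gd: "GDERIV h y :> gradient h y" for y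
    using continuously_differentiable_imp_GDERIV[OF h_C1] .
  have "closed C"
    unfolding C_eq using continuously_differentiable_imp_continuous_on[OF h_C1]
    by (intro closed_Collect_le continuous_intros) auto
  have "0 \<in> C" using h_origin by (simp add: C_eq)
  have r0: "r (2 * pi) = r 0" using r_periodic[of 0] by simp
  have out: "t *\<^sub>R x \<notin> C" if "x \<in> frontier C" "t > 1" for x t
    using that(1) polar_frontier_outside[OF \<open>closed C\<close> \<open>0 \<in> C\<close> continuously_differentiable_imp_continuous_on[OF r_C1]
        r_pos r0 frontier_polar _ that(2)]
    unfolding frontier_polar by blast
  have bdd: "bounded C" if "x \<in> frontier C" "x \<noteq> 0" for x
  proof (rule bounded_frontier_imp_bounded[OF _ _ that out])
    show "bounded (frontier C)"
      unfolding frontier_polar vector_2_axis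
      by (intro compact_imp_bounded compact_continuous_image continuous_intros compact_Icc
          continuously_differentiable_imp_continuous_on[OF r_C1])
  qed (use that(1) in auto)
  have Mx0: "M *v x \<noteq> 0" if "x \<noteq> 0" for x
    using hurwitz_real_eigenvalue_neg[OF M that, of 0] by auto
  \<comment> \<open>Serves both conclusions: \<delta> comes from the definition of undesired
    equilibria in one and is \<open>\<eta> / q\<close> in the other.\<close>
  have no_equilibrium: False
    if x: "h x = 0" "\<delta> < 0" "M *v x = (\<delta> * \<gamma> x * (gradient h x \<bullet> b)) *\<^sub>R b" for x \<delta>
  proof -
    have "x \<noteq> 0" using x(1) h_origin by auto
    then have nz: "gradient h x \<bullet> b \<noteq> 0" using Mx0 x(3) by force
    have fx: "x \<in> frontier C" using x(1) frontier_C by simp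
    have "gradient h x \<bullet> (M *v x) \<ge> 0"
    proof (rule nominal_inflow_on_input_line[OF M gd])
      show "bounded {y. h y \<ge> 0}" using bdd[OF fx \<open>x \<noteq> 0\<close>] by (simp add: C_eq)
      show "h x = 0" by fact
      show "h (t *\<^sub>R x) < 0" if "t > 1" for t
        using out[OF fx that] by (simp add: C_eq)
      show "gradient h y \<bullet> (M *v y) > 0" if y: "h y = 0" "gradient h y \<bullet> (M *v x) = 0" for y
      proof -
        \<comment> \<open>\<open>M *v x\<close> is a nonzero multiple of \<open>b\<close>, so
          orthogonality to one is orthogonality to the other.\<close>
        have gb: "gradient h y \<bullet> b = 0" using y(2) nz x(2) \<gamma>[of x] by (simp add: x(3))
        then have B0: "gradient h y \<bullet> (B *v w) = 0" for w
          by (simp add: matrix_vector_mult_col[of B] flip: b_def)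
        obtain u where "gradient h y \<bullet> (A *v y + B *v u) + \<alpha>\<^sub>0 * h y > 0"
          using cbf y(1) unfolding strict_CBF_def C_eq by (metis mem_Collect_eq order_refl)
        moreover have "M *v y = A *v y - B *v (K *v y)"
          by (simp add: M_def matrix_vector_mult_diff_rdistrib matrix_vector_mul_assoc)
        ultimately show ?thesis
          by (simp add: B0 y(1) inner_add_right inner_diff_right)
      qed
    qed
    \<comment> \<open>A negative \<delta> times a positive square term contradicts the inflow just
      obtained.\<close>
    moreover have "gradient h x \<bullet> (M *v x) = \<delta> * (\<gamma> x * (gradient h x \<bullet> b)\<^sup>2)"
      by (simp add: x(3) power2_eq_square)
    moreover have "\<gamma> x * (gradient h x \<bullet> b)\<^sup>2 > 0" using \<gamma>[of x] nz by simp
    ultimately show False using x(2) by (simp add: zero_le_mult_iff)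
  qed
  have "undesired_equilibria A B K G h = {}"
    unfolding undesired_equilibria_def M_def[symmetric]
    using no_equilibrium
    by (auto simp: dir[unfolded matrix_vector_mul_assoc matrix_mul_assoc] mult.assoc)
  moreover have "{x \<in> C. filtered_field A B K G h (\<lambda>s. \<alpha>\<^sub>0 * s) x = 0 \<and> x \<noteq> 0} = {}"
  proof (rule ccontr)
    assume "\<not> ?thesis"
    then obtain x where x: "x \<noteq> 0" "filtered_field A B K G h (\<lambda>s. \<alpha>\<^sub>0 * s) x = 0" by blast
    define g where "g = gradient h x"
    define \<eta> where "\<eta> = g \<bullet> (M *v x) + \<alpha>\<^sub>0 * h x"
    define q where "q = \<gamma> x * (g \<bullet> b)\<^sup>2"
    have f: "M *v x + B *v safety_filter A B K G h (\<lambda>s. \<alpha>\<^sub>0 * s) x = 0"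
      using x(2) by (simp add: filtered_field_def M_def)
    \<comment> \<open>An inactive filter would leave \<open>M *v x = 0\<close>, impossible since 0
      is not an eigenvalue of \<open>M\<close>.\<close>
    have "\<not> \<eta> \<ge> 0"
      using f Mx0[OF x(1)]
      by (auto simp: safety_filter_def nominal_margin_def \<eta>_def g_def M_def)
    moreover define w where "w = (matrix_inv (G x) ** transpose B) *v g"
    ultimately have "safety_filter A B K G h (\<lambda>s. \<alpha>\<^sub>0 * s) x = (- (\<eta> / (g \<bullet> (B *v w)))) *\<^sub>R w"
      unfolding safety_filter_def nominal_margin_def \<eta>_def g_def M_def Let_def by simp
    then have "B *v safety_filter A B K G h (\<lambda>s. \<alpha>\<^sub>0 * s) x = - ((\<eta> / (g \<bullet> (B *v w))) *\<^sub>R (B *v w))"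
      by (simp only: matrix_vector_mult_scaleR) simp
    then have "M *v x = (\<eta> / (g \<bullet> (B *v w))) *\<^sub>R (B *v w)"
      using f by simp
    then have Mx: "M *v x = (\<eta> / q) *\<^sub>R ((\<gamma> x * (g \<bullet> b)) *\<^sub>R b)"
      by (simp only: w_def dir q_def power2_eq_square inner_scaleR_right mult.assoc)
    \<comment> \<open>Division by zero yields 0, so \<open>q = 0\<close> would again force
      \<open>M *v x = 0\<close>.\<close>
    have "q \<noteq> 0" using Mx Mx0[OF x(1)] by auto
    then have q: "q > 0" using \<gamma>[of x] by (simp add: q_def less_le)
    \<comment> \<open>The active filter makes the nominal derivative of \<open>h\<close> equal to
      \<eta>; comparison with the definition of \<eta> leaves
      \<open>\<alpha>\<^sub>0 * h x = 0\<close>, which places \<open>x\<close> on the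
      boundary.\<close>
    have "g \<bullet> (M *v x) = \<eta> / q * q"
      unfolding Mx by (simp add: q_def power2_eq_square)
    then have "h x = 0" using q \<alpha> by (simp add: \<eta>_def)
    moreover have "\<eta> / q < 0" using q \<open>\<not> \<eta> \<ge> 0\<close> by (simp add: divide_neg_pos)
    ultimately show False
      using no_equilibrium[of x "\<eta> / q"] Mx by (simp add: g_def mult.assoc)
  qed
  ultimately show "undesired_equilibria A B K G h = {} \<and>
      {x \<in> C. filtered_field A B K G h (\<lambda>s. \<alpha>\<^sub>0 * s) x = 0 \<and> x \<noteq> 0} = {}"
    by blast
qed

end
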